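(* Fix an integer $k\ge2$, $n\ge1$, $\lambda_n>0$, and let $x_1,\dots,x_n\in\mathbb{R}$ be arbitrary. Let $$\ell_n^{\mathrm{pen}}(\theta)=\sum_{i=1}^n\log f_\theta(x_i)-n\lambda_n\sum_{j=1}^k\big(\mu_j^2+(\log\sigma_j)^2\big),\qquad\theta=(\pi,\mu,\sigma)\in\Theta_k.$$ Then $\ell_n^{\mathrm{pen}}(\theta)\to-\infty$ whenever $\|\mu\|\to\infty$ or $\max_j|\log\sigma_j|\to\infty$. Consequently, $\ell_n^{\mathrm{pen}}$ attains its maximum over $\Theta_k$.
   Context: $\Theta_k=\Delta_{k-1}\times\mathbb{R}^k\times(0,\infty)^k$ with $\Delta_{k-1}=\{\pi\in[0,1]^k:\sum_j\pi_j=1\}$. The $k$-component Gaussian mixture density is $f_\theta(x)=\sum_{j=1}^k\pi_j\varphi(x;\mu_j,\sigma_j)$, where $\varphi(x;\mu,\sigma)=\frac{1}{\sqrt{2\pi}\,\sigma}\exp(-\frac{(x-\mu)^2}{2\sigma^2})$. The divergence statement means: for every sequence in $\Theta_k$ along which $\|\mu\|\to\infty$ or $\max_j|\log\sigma_j|\to\infty$, $\ell_n^{\mathrm{pen}}\to-\infty$ along that sequence. *)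

theory Defs
  imports "HOL-Probability.Distributions"
begin

text \<open>The number of components \<open>k\<close> is \<open>CARD('k)\<close>; a parameter is a triple \<open>(w, \<mu>, \<sigma>)\<close> of
  vectors indexed by \<open>'k\<close>, with \<open>w\<close> the mixture weights (\<open>pi\<close> being taken by the circle constant).\<close>

type_synonym 'k param = "(real ^ 'k) \<times> (real ^ 'k) \<times> (real ^ 'k)"

definition prob_simplex :: "(real ^ 'k::finite) set" where
  "prob_simplex = {w. (\<forall>j. w $ j \<in> {0..1}) \<and> (\<Sum>j\<in>UNIV. w $ j) = 1}"

definition param_space :: "'k::finite param set" where
  "param_space = prob_simplex \<times> UNIV \<times> {\<sigma>. \<forall>j. \<sigma> $ j \<in> {0<..}}"

text \<open>The library density \<open>normal_density m s x\<close> has prefactor \<open>1 / sqrt (2 * pi * s\<^sup>2)\<close>,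
  which for \<open>s > 0\<close> is \<open>1 / (sqrt (2 * pi) * s)\<close>.\<close>

fun mixture_density :: "'k::finite param \<Rightarrow> real \<Rightarrow> real" where
  "mixture_density (w, \<mu>, \<sigma>) x = (\<Sum>j\<in>UNIV. w $ j * normal_density (\<mu> $ j) (\<sigma> $ j) x)"

text \<open>On \<^const>\<open>param_space\<close> the mixture density is positive, so \<^const>\<open>ln\<close> is never applied
  outside its usual domain.\<close>

fun pen_loglik :: "nat \<Rightarrow> real \<Rightarrow> (nat \<Rightarrow> real) \<Rightarrow> 'k::finite param \<Rightarrow> real" where
  "pen_loglik n lam x (w, \<mu>, \<sigma>) =
     (\<Sum>i = 1..n. ln (mixture_density (w, \<mu>, \<sigma>) (x i)))
     - real n * lam * (\<Sum>j\<in>UNIV. (\<mu> $ j)\<^sup>2 + (ln (\<sigma> $ j))\<^sup>2)"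

end

theory Submission
  imports Defs
begin

text \<open>Each component is at most \<open>1 / \<sigma>\<^sub>j = exp (- ln \<sigma>\<^sub>j)\<close>, so the log-likelihood grows at most
  linearly in \<open>max\<^sub>j \<bar>ln \<sigma>\<^sub>j\<bar>\<close>, and AM-GM absorbs it into half of the quadratic penalty. In the
  coordinates \<open>(w, \<mu>, ln \<sigma>)\<close> the maximisation therefore reduces to a compact set.\<close>

text \<open>The factor \<open>sqrt (2 * pi)\<close> is at least 1 and the exponential is at most 1.
  The bound is free of \<open>m\<close> and \<open>y\<close>, which is why the data points can be
  arbitrary.\<close>

lemma normal_density_le_inverse:
  assumes "0 < s"
  shows "normal_density m s y \<le> 1 / s"
proof -
  have "1 * s \<le> sqrt (2 * pi) * s"
    using assms pi_ge_two by (intro mult_right_mono) auto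
  then have "s \<le> sqrt (2 * pi * s\<^sup>2)"
    using assms by (simp add: real_sqrt_mult)
  then have "1 / sqrt (2 * pi * s\<^sup>2) * exp (- (y - m)\<^sup>2 / (2 * s\<^sup>2)) \<le> 1 / s * 1"
    using assms by (intro mult_mono divide_left_mono) auto
  then show ?thesis
    by (simp add: normal_density_def)
qed

text \<open>Weights summing to 1 cannot all vanish, and one positive weight gives a positive
  summand. Monotonicity and continuity of \<open>ln\<close> along the density rest on this.\<close>

lemma mixture_density_pos:
  fixes w \<mu> \<sigma> :: "real ^ 'k::finite"
  assumes "(w, \<mu>, \<sigma>) \<in> param_space"
  shows "0 < mixture_density (w, \<mu>, \<sigma>) y"
proof -
  have w: "\<And>j. 0 \<le> w $ j" "(\<Sum>j\<in>UNIV. w $ j) = 1" and s: "\<And>j. 0 < \<sigma> $ j"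
    using assms by (auto simp: param_space_def prob_simplex_def)
  obtain j where "w $ j \<noteq> 0"
    using w(2) by (metis sum.neutral zero_neq_one)
  then have "0 < w $ j * normal_density (\<mu> $ j) (\<sigma> $ j) y"
    using w(1)[of j] s by (simp add: normal_density_pos)
  then show ?thesis
    unfolding mixture_density.simps using w(1) s
    by (intro sum_pos2[where i = j]) auto
qed

lemma mixture_density_le:
  fixes w \<mu> \<sigma> :: "real ^ 'k::finite"
  assumes "(w, \<mu>, \<sigma>) \<in> param_space" and "\<And>j. 1 / \<sigma> $ j \<le> B"
  shows "mixture_density (w, \<mu>, \<sigma>) y \<le> B"
proof -
  have w: "\<And>j. 0 \<le> w $ j" "(\<Sum>j\<in>UNIV. w $ j) = 1" and s: "\<And>j. 0 < \<sigma> $ j"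
    using assms by (auto simp: param_space_def prob_simplex_def)
  have "mixture_density (w, \<mu>, \<sigma>) y \<le> (\<Sum>j\<in>UNIV. w $ j * B)"
    unfolding mixture_density.simps
    using w(1) assms(2) order_trans[OF normal_density_le_inverse[OF s]]
    by (intro sum_mono mult_left_mono) auto
  also have "\<dots> = B"
    using w(2) by (simp flip: sum_distrib_right)
  finally show ?thesis .
qed

text \<open>Half of the penalty pays for the log-likelihood. The resulting bound is uniform in
  \<open>w\<close> and \<open>x\<close>, and both the divergence and the existence of a maximum
  follow from it.\<close>

lemma pen_loglik_le:
  fixes w \<mu> \<sigma> :: "real ^ 'k::finite"
  assumes "(w, \<mu>, \<sigma>) \<in> param_space" and "0 < lam"
  shows "pen_loglik n lam x (w, \<mu>, \<sigma>)
    \<le> real n * (1 / (2 * lam) - lam / 2 * (\<Sum>j\<in>UNIV. (\<mu> $ j)\<^sup>2 + (ln (\<sigma> $ j))\<^sup>2))"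
proof -
  define P where "P = (\<Sum>j\<in>UNIV. (\<mu> $ j)\<^sup>2 + (ln (\<sigma> $ j))\<^sup>2)"
  \<comment> \<open>\<open>P\<close> dominates the penalty term of every component, so a single
    constant serves for all \<open>j\<close>, as \<open>mixture_density_le\<close> requires.\<close>
  have "1 / \<sigma> $ j \<le> exp (lam / 2 * P + 1 / (2 * lam))" for j
  proof -
    have s: "0 < \<sigma> $ j"
      using assms by (auto simp: param_space_def)
    have "(\<mu> $ j)\<^sup>2 + (ln (\<sigma> $ j))\<^sup>2 \<le> P"
      unfolding P_def by (rule member_le_sum) auto
    then have "(ln (\<sigma> $ j))\<^sup>2 \<le> P"
      using zero_le_power2[of "\<mu> $ j"] by linarith
    then have "lam / 2 * (ln (\<sigma> $ j))\<^sup>2 \<le> lam / 2 * P"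
      using assms(2) by simp
    \<comment> \<open>Expanding this square gives the AM-GM inequality below.\<close>
    moreover have "0 \<le> (lam * ln (\<sigma> $ j) + 1)\<^sup>2 / (2 * lam)"
      using assms(2) by simp
    then have "- ln (\<sigma> $ j) \<le> lam / 2 * (ln (\<sigma> $ j))\<^sup>2 + 1 / (2 * lam)"
      using assms(2) by (simp add: field_simps power2_eq_square)
    ultimately have "exp (- ln (\<sigma> $ j)) \<le> exp (lam / 2 * P + 1 / (2 * lam))"
      by simp
    then show ?thesis
      using s by (simp add: exp_minus field_simps)
  qed
  then have "ln (mixture_density (w, \<mu>, \<sigma>) y) \<le> lam / 2 * P + 1 / (2 * lam)" for y
    using mixture_density_le[OF assms(1)] mixture_density_pos[OF assms(1), of y]
    by (metis ln_exp ln_mono)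
  then have "(\<Sum>i = 1..n. ln (mixture_density (w, \<mu>, \<sigma>) (x i)))
      \<le> real n * (lam / 2 * P + 1 / (2 * lam))"
    using sum_bounded_above[of "{1..n}" "\<lambda>i. ln (mixture_density (w, \<mu>, \<sigma>) (x i))"
        "lam / 2 * P + 1 / (2 * lam)"] by simp
  then show ?thesis
    unfolding pen_loglik.simps P_def[symmetric] by (simp add: algebra_simps)
qed

lemma power2_norm_vec: "(norm v)\<^sup>2 = (\<Sum>j\<in>UNIV. (v $ j)\<^sup>2)" for v :: "real ^ 'k::finite"
  by (simp add: norm_vec_def L2_set_def sum_nonneg)

lemma compact_prob_simplex: "compact (prob_simplex :: (real ^ 'k::finite) set)"
proof -
  have "norm w \<le> 1" if "w \<in> prob_simplex" for w :: "real ^ 'k"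
  proof -
    have "norm w \<le> (\<Sum>j\<in>UNIV. \<bar>w $ j\<bar>)"
      by (rule norm_le_l1_cart)
    also have "\<dots> = (\<Sum>j\<in>UNIV. w $ j)"
      using that by (intro sum.cong) (auto simp: prob_simplex_def)
    finally show ?thesis
      using that by (simp add: prob_simplex_def)
  qed
  then have "bounded (prob_simplex :: (real ^ 'k) set)"
    by (auto simp: bounded_iff)
  moreover have "closed (prob_simplex :: (real ^ 'k) set)"
    unfolding prob_simplex_def atLeastAtMost_iff
    by (intro closed_Collect_conj closed_Collect_all closed_Collect_le closed_Collect_eq
        continuous_intros)
  ultimately show ?thesis
    by (simp add: compact_eq_bounded_closed)
qed

text \<open>Logarithmic scales \<open>t\<close> turn the open constraint of positive scales into no
  constraint at all, so closed balls in \<open>t\<close> are admissible.\<close>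

lemma exp_param_space_iff:
  "(w, \<mu>, \<chi> j. exp (t $ j)) \<in> param_space \<longleftrightarrow> w \<in> prob_simplex"
  by (simp add: param_space_def)

text \<open>In these coordinates the penalty is a polynomial in \<open>\<mu>\<close> and
  \<open>t\<close>, and the density stays positive even where some weights vanish.\<close>

lemma continuous_on_pen_loglik_exp:
  "continuous_on (prob_simplex \<times> UNIV)
    (\<lambda>(w, \<mu>, t). pen_loglik n lam x (w, \<mu>, \<chi> j. exp (t $ j)))"
proof -
  have "continuous_on (prob_simplex \<times> UNIV)
    (\<lambda>p. ln (mixture_density (fst p, fst (snd p), \<chi> j. exp (snd (snd p) $ j)) y))" for y
  proof (rule continuous_on_ln)
    show "continuous_on (prob_simplex \<times> UNIV)
      (\<lambda>p. mixture_density (fst p, fst (snd p), \<chi> j. exp (snd (snd p) $ j)) y)"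
      unfolding mixture_density.simps normal_density_def
      by (intro continuous_intros) auto
    show "\<forall>p\<in>prob_simplex \<times> UNIV.
      mixture_density (fst p, fst (snd p), \<chi> j. exp (snd (snd p) $ j)) y \<noteq> 0"
      using mixture_density_pos exp_param_space_iff
      by (metis less_irrefl mem_Times_iff)
  qed
  then have "continuous_on (prob_simplex \<times> UNIV)
    (\<lambda>p. \<Sum>i = 1..n. ln (mixture_density (fst p, fst (snd p), \<chi> j. exp (snd (snd p) $ j)) (x i)))"
    by (rule continuous_on_sum)
  then show ?thesis
    unfolding pen_loglik.simps case_prod_unfold vec_lambda_beta ln_exp
    by (rule continuous_on_diff) (intro continuous_intros)
qed

text \<open>The minorant \<open>r\<close> covers both modes of divergence at once: it can be the
  norm of \<open>\<mu>\<close> or the largest \<open>\<bar>ln \<sigma>\<bar>\<close>.\<close>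

lemma pen_loglik_tendsto_at_bot:
  fixes w \<mu> \<sigma> :: "nat \<Rightarrow> real ^ 'k::finite"
  assumes "\<And>m. (w m, \<mu> m, \<sigma> m) \<in> param_space" and "0 < lam" and "1 \<le> n"
    and "filterlim r at_top F" and "\<And>m. 0 \<le> r m"
    and "\<And>m. (r m)\<^sup>2 \<le> (\<Sum>j\<in>UNIV. (\<mu> m $ j)\<^sup>2 + (ln (\<sigma> m $ j))\<^sup>2)"
  shows "filterlim (\<lambda>m. pen_loglik n lam x (w m, \<mu> m, \<sigma> m)) at_bot F"
proof (rule filterlim_at_bot_mono)
  let ?q = "\<lambda>m. real n * (1 / (2 * lam) - lam / 2 * (r m)\<^sup>2)"
  \<comment> \<open>This is the negative of \<open>?q\<close>; its leading coefficient is positive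
    because \<open>1 \<le> n\<close> and \<open>0 < lam\<close>.\<close>
  have "filterlim (\<lambda>m. - (real n / (2 * lam)) + real n * (lam / 2) * (r m)\<^sup>2) at_top F"
    using assms
    by (intro filterlim_tendsto_add_at_top[OF tendsto_const]
        filterlim_tendsto_pos_mult_at_top[OF tendsto_const] filterlim_pow_at_top) auto
  then show "filterlim ?q at_bot F"
    unfolding filterlim_uminus_at_top by (simp add: algebra_simps)
  have "pen_loglik n lam x (w m, \<mu> m, \<sigma> m) \<le> ?q m" for m
  proof (rule order_trans[OF pen_loglik_le[OF assms(1,2)]])
    show "real n * (1 / (2 * lam) - lam / 2 * (\<Sum>j\<in>UNIV. (\<mu> m $ j)\<^sup>2 + (ln (\<sigma> m $ j))\<^sup>2)) \<le> ?q m"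
      using assms(2,6) by (intro mult_left_mono diff_left_mono) auto
  qed
  then show "\<forall>\<^sub>F m in F. pen_loglik n lam x (w m, \<mu> m, \<sigma> m) \<le> ?q m"
    by simp
qed

text \<open>Outside a large compact set the bound of \<open>pen_loglik_le\<close> is at most the
  value at a fixed point inside, so a maximiser over that set is global.\<close>

lemma pen_loglik_attains_max:
  assumes "0 < lam" and "1 \<le> n"
  shows "\<exists>\<theta> \<in> (param_space :: 'k::finite param set). \<forall>\<theta>' \<in> (param_space :: 'k param set).
    pen_loglik n lam x \<theta>' \<le> pen_loglik n lam x \<theta>"
proof -
  let ?h = "\<lambda>(w, \<mu>, t). pen_loglik n lam x (w, \<mu>, (\<chi> j. exp (t $ j)) :: real ^ 'k)"
  define w0 :: "real ^ 'k" where "w0 = (\<chi> j. 1 / CARD('k))"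
  have w0: "w0 \<in> prob_simplex"
    by (simp add: w0_def prob_simplex_def)
  \<comment> \<open>The reference point has all means 0 and all scales 1; it lies in
    \<open>K\<close> for every positive \<open>R\<close>.\<close>
  define c where "c = ?h (w0, 0, 0)"
  obtain R where R: "0 < R" "\<And>r. R \<le> r \<Longrightarrow> real n * (1 / (2 * lam) - lam / 2 * r\<^sup>2) \<le> c"
  proof
    \<comment> \<open>The summand 1 yields \<open>r \<le> r\<^sup>2\<close>. Multiplied by
      \<open>lam / 2\<close>, the other two become \<open>1 / (2 * lam)\<close>, which cancels the
      constant, and \<open>\<bar>c\<bar>\<close>.\<close>
    define R where "R = 1 + 1 / lam\<^sup>2 + 2 * \<bar>c\<bar> / lam"
    show "0 < R"
      unfolding R_def using assms by (intro add_pos_nonneg) auto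
    have "1 \<le> R"
      unfolding R_def using assms by simp
    fix r assume "R \<le> r"
    moreover have "r \<le> r\<^sup>2"
      using \<open>1 \<le> R\<close> \<open>R \<le> r\<close> by (simp add: power2_eq_square)
    ultimately have "lam / 2 * (1 / lam\<^sup>2 + 2 * \<bar>c\<bar> / lam) \<le> lam / 2 * r\<^sup>2"
      using assms unfolding R_def by (intro mult_left_mono) auto
    moreover have "lam / 2 * (1 / lam\<^sup>2 + 2 * \<bar>c\<bar> / lam) = 1 / (2 * lam) + \<bar>c\<bar>"
      using assms by (simp add: field_simps power2_eq_square)
    ultimately have "1 / (2 * lam) - lam / 2 * r\<^sup>2 \<le> - \<bar>c\<bar>"
      by linarith
    then have "real n * (1 / (2 * lam) - lam / 2 * r\<^sup>2) \<le> real n * (- \<bar>c\<bar>)"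
      by (intro mult_left_mono) auto
    also have "\<dots> \<le> - \<bar>c\<bar>"
      using assms mult_right_mono[of 1 "real n" "\<bar>c\<bar>"] by simp
    finally show "real n * (1 / (2 * lam) - lam / 2 * r\<^sup>2) \<le> c"
      by linarith
  qed
  define K :: "((real ^ 'k) \<times> (real ^ 'k) \<times> (real ^ 'k)) set"
    where "K = prob_simplex \<times> cball 0 R \<times> cball 0 R"
  have "(w0, 0, 0) \<in> K"
    using w0 R by (simp add: K_def)
  moreover have "compact K"
    unfolding K_def by (intro compact_Times compact_prob_simplex compact_cball)
  moreover have "continuous_on K ?h"
    by (rule continuous_on_subset[OF continuous_on_pen_loglik_exp]) (auto simp: K_def)
  ultimately obtain p where p: "p \<in> K" "\<And>q. q \<in> K \<Longrightarrow> ?h q \<le> ?h p"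
    using continuous_attains_sup[of K ?h] by blast
  obtain w \<mu> t where wmt: "p = (w, \<mu>, t)"
    by (cases p)
  have "c \<le> ?h p"
    unfolding c_def by (rule p(2)) fact
  have "pen_loglik n lam x (w', \<mu>', \<sigma>') \<le> ?h p"
    if in_space: "(w', \<mu>', \<sigma>') \<in> param_space" for w' \<mu>' \<sigma>' :: "real ^ 'k"
  proof -
    \<comment> \<open>The change of coordinates is onto, so no parameter is missed.\<close>
    define t' where "t' = (\<chi> j. ln (\<sigma>' $ j))"
    have \<sigma>': "\<sigma>' = (\<chi> j. exp (t' $ j))"
      using in_space by (simp add: t'_def vec_eq_iff param_space_def)
    show ?thesis
    proof (cases "norm \<mu>' \<le> R \<and> norm t' \<le> R")
      case True
      then have "(w', \<mu>', t') \<in> K"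
        using in_space by (auto simp: K_def param_space_def)
      from p(2)[OF this] show ?thesis
        using \<sigma>' by simp
    next
      case False
      let ?P = "\<Sum>j\<in>UNIV. (\<mu>' $ j)\<^sup>2 + (ln (\<sigma>' $ j))\<^sup>2"
      have P: "?P = (norm \<mu>')\<^sup>2 + (norm t')\<^sup>2"
        by (simp add: power2_norm_vec sum.distrib t'_def)
      have "R\<^sup>2 \<le> ?P"
        using False R(1) power_mono[of R "norm \<mu>'" 2] power_mono[of R "norm t'" 2]
        unfolding P by (smt (verit) zero_le_power2)
      \<comment> \<open>The choice of \<open>R\<close> concerns radii, hence it is applied at
        \<open>sqrt ?P\<close>.\<close>
      then have "R \<le> sqrt ?P"
        by (rule real_le_rsqrt)
      from R(2)[OF this] have "real n * (1 / (2 * lam) - lam / 2 * ?P) \<le> c"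
        by (simp add: P)
      with pen_loglik_le[OF in_space assms(1), of n x] \<open>c \<le> ?h p\<close> show ?thesis
        by linarith
    qed
  qed
  then have "\<forall>\<theta>' \<in> (param_space :: 'k param set). pen_loglik n lam x \<theta>'
      \<le> pen_loglik n lam x (w, \<mu>, \<chi> j. exp (t $ j))"
    unfolding wmt prod.case Ball_def split_paired_All by blast
  moreover have "(w, \<mu>, \<chi> j. exp (t $ j)) \<in> param_space"
    using p(1) by (simp add: exp_param_space_iff wmt K_def)
  ultimately show ?thesis
    by (rule bexI)
qed

theorem lemmaC1:
  fixes n :: nat and lam :: real and x :: "nat \<Rightarrow> real"
  assumes "CARD('k::finite) \<ge> 2" and "n \<ge> 1" and "lam > 0"
  shows "(\<forall>w \<mu> \<sigma> :: nat \<Rightarrow> real ^ 'k.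
            (\<forall>m. (w m, \<mu> m, \<sigma> m) \<in> param_space) \<longrightarrow>
            filterlim (\<lambda>m. norm (\<mu> m)) at_top sequentially \<or>
            filterlim (\<lambda>m. MAX j. \<bar>ln (\<sigma> m $ j)\<bar>) at_top sequentially \<longrightarrow>
            filterlim (\<lambda>m. pen_loglik n lam x (w m, \<mu> m, \<sigma> m)) at_bot sequentially) \<and>
         (\<exists>\<theta> \<in> (param_space :: 'k param set). \<forall>\<theta>' \<in> (param_space :: 'k param set).
            pen_loglik n lam x \<theta>' \<le> pen_loglik n lam x \<theta>)"
proof (intro conjI allI impI)
  fix w \<mu> \<sigma> :: "nat \<Rightarrow> real ^ 'k"
  assume in_space: "\<forall>m. (w m, \<mu> m, \<sigma> m) \<in> param_space"
  assume "filterlim (\<lambda>m. norm (\<mu> m)) at_top sequentially \<or>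
    filterlim (\<lambda>m. MAX j. \<bar>ln (\<sigma> m $ j)\<bar>) at_top sequentially"
  then show "filterlim (\<lambda>m. pen_loglik n lam x (w m, \<mu> m, \<sigma> m)) at_bot sequentially"
  proof
    assume "filterlim (\<lambda>m. norm (\<mu> m)) at_top sequentially"
    then show ?thesis
      using in_space assms
      by (intro pen_loglik_tendsto_at_bot[where r = "\<lambda>m. norm (\<mu> m)"])
        (auto simp: power2_norm_vec intro!: sum_mono)
  next
    assume lim: "filterlim (\<lambda>m. MAX j. \<bar>ln (\<sigma> m $ j)\<bar>) at_top sequentially"
    \<comment> \<open>The maximum is attained at some index, so its square is bounded by one summand
      of the penalty.\<close>
    have Max: "\<exists>i. (MAX j. \<bar>ln (\<sigma> m $ j)\<bar>) = \<bar>ln (\<sigma> m $ i)\<bar>" for m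
    proof -
      have "(MAX j. \<bar>ln (\<sigma> m $ j)\<bar>) \<in> range (\<lambda>j. \<bar>ln (\<sigma> m $ j)\<bar>)"
        by (rule Max_in) auto
      then show ?thesis
        by blast
    qed
    have "0 \<le> (MAX j. \<bar>ln (\<sigma> m $ j)\<bar>)" for m
      using Max[of m] by auto
    moreover have "(MAX j. \<bar>ln (\<sigma> m $ j)\<bar>)\<^sup>2 \<le> (\<Sum>j\<in>UNIV. (\<mu> m $ j)\<^sup>2 + (ln (\<sigma> m $ j))\<^sup>2)" for m
    proof -
      obtain i where "(MAX j. \<bar>ln (\<sigma> m $ j)\<bar>) = \<bar>ln (\<sigma> m $ i)\<bar>"
        using Max by blast
      then have "(MAX j. \<bar>ln (\<sigma> m $ j)\<bar>)\<^sup>2 \<le> (\<mu> m $ i)\<^sup>2 + (ln (\<sigma> m $ i))\<^sup>2"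
        by simp
      also have "\<dots> \<le> (\<Sum>j\<in>UNIV. (\<mu> m $ j)\<^sup>2 + (ln (\<sigma> m $ j))\<^sup>2)"
        by (rule member_le_sum) auto
      finally show ?thesis .
    qed
    ultimately show ?thesis
      using in_space assms lim
      by (intro pen_loglik_tendsto_at_bot[where r = "\<lambda>m. MAX j. \<bar>ln (\<sigma> m $ j)\<bar>"]) auto
  qed
next
  show "\<exists>\<theta> \<in> (param_space :: 'k param set). \<forall>\<theta>' \<in> (param_space :: 'k param set).
      pen_loglik n lam x \<theta>' \<le> pen_loglik n lam x \<theta>"
    using assms by (intro pen_loglik_attains_max)
qed

end
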